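(* Let $G$ be a connected graph on $n$ vertices with chromatic number $\chi=\chi(G)$, fix a proper coloring of $G$ with exactly $\chi$ color classes, and let $\ell_1\ge\ell_2\ge\cdots\ge\ell_\chi\ge 1$ be the sizes of its color classes. Form the ordered list $\Theta=(\theta_1,\dots,\theta_{n-\chi})$ by writing $n+\ell_j$ exactly $\ell_j-1$ times for every $j$ with $\ell_j\ge 2$, and then arranging the resulting numbers in nonincreasing order. Then, for every $1\le r\le n-\chi$, $$\sum_{i=1}^{r}\partial_i^{L}(G)\ge\sum_{i=1}^{r}\theta_i.$$ In particular, $$\sum_{i=1}^{n-\chi}\partial_i^{L}(G)\ge\sum_{j=1}^{\chi}(\ell_j-1)(n+\ell_j),$$ where a term with $\ell_j=1$ contributes zero.
   Context: Graphs are finite, simple and undirected. For a connected graph $G$ with vertices $v_1,\dots,v_n$, let $d_G(u,v)$ be the length of a shortest $u$–$v$ path, $D(G)=(d_G(v_i,v_j))_{i,j}$ the distance matrix, and $\operatorname{Tr}_G(v)=\sum_{u\in V(G)}d_G(u,v)$ the transmission of $v$. The distance Laplacian matrix is $\mathcal{D}^{L}(G)=\operatorname{diag}(\operatorname{Tr}_G(v_1),\dots,\operatorname{Tr}_G(v_n))-D(G)$, a real symmetric positive semidefinite matrix with $\mathcal{D}^{L}(G)\mathbf 1=\mathbf 0$. Its eigenvalues, listed with multiplicity, are ordered $\partial^{L}_1(G)\ge\partial^{L}_2(G)\ge\cdots\ge\partial^{L}_n(G)=0$. A proper coloring is a partition of $V(G)$ into nonempty independent sets (color classes); $\chi(G)$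 is the least number of classes. *)

theory Defs
  imports
    "Graph_Theory.Graph_Theory"
    "Jordan_Normal_Form.Char_Poly"
    "HOL-Library.Disjoint_Sets"
    "HOL-Library.Multiset"
begin

text \<open>
  A finite simple undirected graph is an instance of the locale \<open>graph\<close>: a finite
  loop-free symmetric digraph without parallel arcs, each edge being a pair of opposite arcs.
\<close>

subsection \<open>Distance Laplacian\<close>

text \<open>The length of a path is its number of arcs. The value is unspecified if \<open>v\<close> is not
  reachable from \<open>u\<close>, which does not happen for vertices of a connected graph.\<close>

definition graph_dist :: "('a, 'b) pre_digraph \<Rightarrow> 'a \<Rightarrow> 'a \<Rightarrow> nat" where
  "graph_dist G u v = (LEAST k. \<exists>p. pre_digraph.apath G u p v \<and> length p = k)"

definition transmission :: "('a, 'b) pre_digraph \<Rightarrow> 'a \<Rightarrow> nat" where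
  "transmission G v = (\<Sum>u\<in>verts G. graph_dist G u v)"

text \<open>In the matrices, \<open>vs\<close> is the enumeration of the vertices that indexes rows and columns.\<close>

definition distance_matrix :: "('a, 'b) pre_digraph \<Rightarrow> 'a list \<Rightarrow> real mat" where
  "distance_matrix G vs =
     mat (length vs) (length vs) (\<lambda>(i, j). real (graph_dist G (vs ! i) (vs ! j)))"

definition distance_laplacian :: "('a, 'b) pre_digraph \<Rightarrow> 'a list \<Rightarrow> real mat" where
  "distance_laplacian G vs =
     mat_diag (length vs) (\<lambda>i. real (transmission G (vs ! i))) - distance_matrix G vs"

text \<open>
  Nonincreasing list of the real eigenvalues with algebraic multiplicity. For a real symmetric
  matrix the characteristic polynomial splits over the reals, so this is the full spectrum and
  its length is the dimension.
\<close>

definition eigenvalues_desc :: "real mat \<Rightarrow> real list" where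
  "eigenvalues_desc A = rev (sorted_list_of_multiset (proots (char_poly A)))"

text \<open>The index \<open>i\<close> starts at 1.\<close>

definition dist_lap_eigenvalue :: "('a, 'b) pre_digraph \<Rightarrow> 'a list \<Rightarrow> nat \<Rightarrow> real" where
  "dist_lap_eigenvalue G vs i = eigenvalues_desc (distance_laplacian G vs) ! (i - 1)"


subsection \<open>Proper colorings\<close>

definition independent_set :: "('a, 'b) pre_digraph \<Rightarrow> 'a set \<Rightarrow> bool" where
  "independent_set G S \<longleftrightarrow> S \<subseteq> verts G \<and> (\<forall>u\<in>S. \<forall>v\<in>S. \<not> u \<rightarrow>\<^bsub>G\<^esub> v)"

definition proper_coloring :: "('a, 'b) pre_digraph \<Rightarrow> 'a set set \<Rightarrow> bool" where
  "proper_coloring G P \<longleftrightarrow> partition_on (verts G) P \<and> (\<forall>C\<in>P. independent_set G C)"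

definition chromatic_number :: "('a, 'b) pre_digraph \<Rightarrow> nat" where
  "chromatic_number G = (LEAST k. \<exists>P. proper_coloring G P \<and> card P = k)"

definition class_sizes :: "'a set set \<Rightarrow> nat list" where
  "class_sizes P = rev (sorted_list_of_multiset (image_mset card (mset_set P)))"

definition Theta_list :: "nat \<Rightarrow> nat list \<Rightarrow> nat list" where
  "Theta_list n ls =
     rev (sort (concat (map (\<lambda>l. replicate (l - 1) (n + l)) (filter (\<lambda>l. l \<ge> 2) ls))))"

end

theory Submission
  imports Defs "HOL-Analysis.Function_Topology"
begin

text \<open>
  A proper coloring places the graph inside the complete multipartite graph on its color classes,
  in which two vertices have distance 2 if they share a class and distance 1 otherwise. Distances
  in the graph are at least as large: distinct vertices have distance at least 1, and vertices of
  one class, not being adjacent, have distance at least 2. The quadratic form of the distance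
  Laplacian is half the sum of \<open>d(u,v) (x u - x v)\<^sup>2\<close> over all ordered pairs of vertices
  (\<open>weighted_laplacian_quadratic_form\<close>), so it is bounded below by the form of the
  multipartite graph. On a vector of coordinate sum zero supported in a class of size \<open>l\<close> the latter
  is exactly \<open>n + l\<close> times the squared length (\<open>laplacian_bound_on_cell\<close>).

  Such vectors form a space of dimension \<open>l - 1\<close> for every class, and different classes give
  orthogonal spaces. Altogether there is an orthonormal system of \<open>n - \<chi>\<close> vectors in which the value
  \<open>n + l\<close> belongs to \<open>l - 1\<close> vectors for every class of size \<open>l\<close>; these are the values in
  the list \<open>\<Theta>\<close>. The Helmert contrasts give such a system explicitly
  (\<open>orthonormal_helmert\<close>). By Ky Fan's inequality (\<open>ky_fan_inequality\<close>), the sum of the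
  quadratic form of a symmetric matrix over \<open>r\<close> orthonormal vectors is at most the sum of its
  \<open>r\<close> largest eigenvalues. Applied to the vectors with the \<open>r\<close> largest values this is the first claim,
  and \<open>r = n - \<chi>\<close> gives the second one.

  Ky Fan's inequality rests on the spectral theorem (\<open>spectral_decomposition\<close>), which is proved by
  maximizing the quadratic form on the unit sphere of the orthogonal complement of the
  eigenvectors found so far. It also shows that the roots of the characteristic polynomial, counted
  with multiplicity, are the eigenvalues in the decomposition (\<open>proots_char_poly_spectral\<close>).
\<close>

section \<open>Orthonormal families\<close>

text \<open>
  Vectors are functions on the natural numbers of which only the coordinates below \<open>n\<close> count.
  This lets the dimension vary, as it must for the vertex number of a graph, and makes the
  product topology on functions available for the compactness argument below.
\<close>

definition dot :: "nat \<Rightarrow> (nat \<Rightarrow> real) \<Rightarrow> (nat \<Rightarrow> real) \<Rightarrow> real" where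
  "dot n x y = (\<Sum>a<n. x a * y a)"

definition orthonormal :: "nat \<Rightarrow> nat \<Rightarrow> (nat \<Rightarrow> nat \<Rightarrow> real) \<Rightarrow> bool" where
  "orthonormal n k u \<longleftrightarrow> (\<forall>i<k. \<forall>j<k. dot n (u i) (u j) = (if i = j then 1 else 0))"

text \<open>
  Coordinates beyond the dimension are set to zero, so that the image lies again among the
  vectors supported below \<open>n\<close> and an eigenvector equation can be an equation of functions.
\<close>

definition apply_mat :: "nat \<Rightarrow> (nat \<Rightarrow> nat \<Rightarrow> real) \<Rightarrow> (nat \<Rightarrow> real) \<Rightarrow> nat \<Rightarrow> real" where
  "apply_mat n A x = (\<lambda>a. if a < n then \<Sum>b<n. A a b * x b else 0)"

lemma dot_commute: "dot n x y = dot n y x"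
  by (simp add: dot_def mult.commute)

lemma dot_add_right: "dot n x (\<lambda>a. y a + z a) = dot n x y + dot n x z"
  and dot_diff_right: "dot n x (\<lambda>a. y a - z a) = dot n x y - dot n x z"
  and dot_scale_right: "dot n x (\<lambda>a. c * y a) = c * dot n x y"
  by (simp_all add: dot_def algebra_simps sum.distrib sum_subtractf sum_distrib_left)

lemma dot_add_left: "dot n (\<lambda>a. y a + z a) x = dot n y x + dot n z x"
  and dot_diff_left: "dot n (\<lambda>a. y a - z a) x = dot n y x - dot n z x"
  and dot_scale_left: "dot n (\<lambda>a. c * y a) x = c * dot n y x"
  by (simp_all add: dot_def algebra_simps sum.distrib sum_subtractf sum_distrib_left)

lemma dot_sum_right: "dot n x (\<lambda>a. \<Sum>i\<in>I. y i a) = (\<Sum>i\<in>I. dot n x (y i))"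
  unfolding dot_def sum_distrib_left by (rule sum.swap)

lemma dot_self_nonneg: "0 \<le> dot n x x"
  by (simp add: dot_def sum_nonneg)

lemma dot_self_eq_0D: "dot n x x = 0 \<Longrightarrow> a < n \<Longrightarrow> x a = 0"
  by (simp add: dot_def sum_nonneg_eq_0_iff)

lemma orthonormalD:
  "orthonormal n k u \<Longrightarrow> i < k \<Longrightarrow> j < k \<Longrightarrow> dot n (u i) (u j) = (if i = j then 1 else 0)"
  by (simp add: orthonormal_def)

lemma apply_mat_add: "apply_mat n A (\<lambda>a. x a + y a) = (\<lambda>a. apply_mat n A x a + apply_mat n A y a)"
  and apply_mat_scale: "apply_mat n A (\<lambda>a. c * x a) = (\<lambda>a. c * apply_mat n A x a)"
  by (auto simp: apply_mat_def algebra_simps sum.distrib sum_distrib_left)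

lemma dot_apply_mat: "dot n y (apply_mat n A x) = (\<Sum>a<n. \<Sum>b<n. A a b * y a * x b)"
  by (simp add: dot_def apply_mat_def sum_distrib_left mult_ac)

lemma dot_apply_mat_symmetric:
  assumes "\<And>a b. a < n \<Longrightarrow> b < n \<Longrightarrow> A a b = A b a"
  shows "dot n y (apply_mat n A x) = dot n (apply_mat n A y) x"
proof -
  have "dot n y (apply_mat n A x) = (\<Sum>b<n. \<Sum>a<n. A a b * y a * x b)"
    unfolding dot_apply_mat by (rule sum.swap)
  also have "\<dots> = (\<Sum>b<n. \<Sum>a<n. A b a * x b * y a)"
    by (intro sum.cong refl) (simp add: assms mult_ac)
  also have "\<dots> = dot n (apply_mat n A y) x"
    by (simp add: dot_apply_mat dot_commute[of n "apply_mat n A y"])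
  finally show ?thesis .
qed

text \<open>
  For an orthonormal family this is \<open>x\<close> minus its orthogonal projection to the span of the family.
\<close>

definition residual :: "nat \<Rightarrow> nat \<Rightarrow> (nat \<Rightarrow> nat \<Rightarrow> real) \<Rightarrow> (nat \<Rightarrow> real) \<Rightarrow> nat \<Rightarrow> real" where
  "residual n k u x = (\<lambda>a. x a - (\<Sum>i<k. dot n (u i) x * u i a))"

lemma residual_orthogonal:
  assumes "orthonormal n k u" "i < k"
  shows "dot n (u i) (residual n k u x) = 0"
proof -
  have "(\<Sum>j<k. dot n (u j) x * dot n (u i) (u j)) = (\<Sum>j<k. if j = i then dot n (u j) x else 0)"
    by (intro sum.cong refl) (use assms in \<open>auto simp: orthonormalD\<close>)
  then show ?thesis
    using assms(2) by (simp add: residual_def dot_diff_right dot_sum_right dot_scale_right)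
qed

lemma dot_residual_self:
  assumes "orthonormal n k u"
  shows "dot n (residual n k u x) (residual n k u x) = dot n x x - (\<Sum>i<k. (dot n (u i) x)\<^sup>2)"
proof -
  let ?z = "residual n k u x"
  have "dot n ?z ?z = dot n ?z x - (\<Sum>i<k. dot n (u i) x * dot n ?z (u i))"
    by (subst (2) residual_def) (simp add: dot_diff_right dot_sum_right dot_scale_right)
  also have "(\<Sum>i<k. dot n (u i) x * dot n ?z (u i)) = 0"
    using residual_orthogonal[OF assms] by (intro sum.neutral) (simp add: dot_commute[of n ?z])
  also have "dot n ?z x - 0 = dot n x ?z"
    by (simp add: dot_commute[of n ?z])
  also have "\<dots> = dot n x x - (\<Sum>i<k. dot n (u i) x * dot n x (u i))"
    by (simp add: residual_def dot_diff_right dot_sum_right dot_scale_right)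
  also have "\<dots> = dot n x x - (\<Sum>i<k. (dot n (u i) x)\<^sup>2)"
    by (metis (no_types) dot_commute power2_eq_square)
  finally show ?thesis .
qed

lemma bessel_inequality:
  assumes "orthonormal n k u"
  shows "(\<Sum>i<k. (dot n (u i) x)\<^sup>2) \<le> dot n x x"
  using dot_self_nonneg[of n "residual n k u x"] dot_residual_self[OF assms, of x] by simp

text \<open>
  An orthonormal family of \<open>k < n\<close> vectors misses some direction: the squared lengths of the
  projections of the \<open>n\<close> standard basis vectors to the span of the family add up to \<open>k\<close>, so one
  of them is less than 1, and the residual of that basis vector is not zero.
\<close>

lemma orthonormal_extend:
  assumes u: "orthonormal n k u" and supp: "\<And>i a. i < k \<Longrightarrow> n \<le> a \<Longrightarrow> u i a = 0" and "k < n"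
  obtains w where "dot n w w = 1" "\<And>i. i < k \<Longrightarrow> dot n (u i) w = 0" "\<And>a. n \<le> a \<Longrightarrow> w a = 0"
proof -
  define e :: "nat \<Rightarrow> nat \<Rightarrow> real" where "e b = (\<lambda>a. if a = b then 1 else 0)" for b
  have e: "dot n x (e b) = x b" if "b < n" for x b
    using that by (simp add: dot_def e_def if_distrib cong: if_cong)
  have "(\<Sum>b<n. \<Sum>i<k. (u i b)\<^sup>2) = (\<Sum>i<k. dot n (u i) (u i))"
    unfolding dot_def power2_eq_square by (rule sum.swap)
  also have "\<dots> = real k"
    by (simp add: orthonormalD[OF u])
  finally have total: "(\<Sum>b<n. \<Sum>i<k. (u i b)\<^sup>2) = real k" .
  have "\<exists>b<n. (\<Sum>i<k. (u i b)\<^sup>2) < 1"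
  proof (rule ccontr)
    assume "\<not> ?thesis"
    then have "(\<Sum>b<n. 1) \<le> (\<Sum>b<n. \<Sum>i<k. (u i b)\<^sup>2)"
      by (intro sum_mono) (meson lessThan_iff not_le)
    with total \<open>k < n\<close> show False by simp
  qed
  then obtain b where b: "b < n" "(\<Sum>i<k. (u i b)\<^sup>2) < 1" by blast
  define z where "z = residual n k u (e b)"
  have "e b b = 1" by (simp add: e_def)
  then have "dot n z z = 1 - (\<Sum>i<k. (u i b)\<^sup>2)"
    unfolding z_def dot_residual_self[OF u] by (simp add: e[OF b(1)])
  with b have pos: "0 < dot n z z" by simp
  define w where "w = (\<lambda>a. (1 / sqrt (dot n z z)) * z a)"
  show thesis
  proof
    show "dot n w w = 1"
      unfolding w_def dot_scale_left dot_scale_right using pos by (simp add: field_simps)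
    show "dot n (u i) w = 0" if "i < k" for i
      unfolding w_def dot_scale_right z_def by (simp add: residual_orthogonal[OF u that])
    show "w a = 0" if "n \<le> a" for a
      using that b by (simp add: w_def z_def residual_def e_def supp)
  qed
qed

section \<open>The spectral theorem for real symmetric matrices\<close>

text \<open>
  Besides orthogonality this demands support below \<open>n\<close>; otherwise the unit sphere would not be
  compact, the coordinates from \<open>n\<close> on being unconstrained.
\<close>

definition orthocomplement :: "nat \<Rightarrow> nat \<Rightarrow> (nat \<Rightarrow> nat \<Rightarrow> real) \<Rightarrow> (nat \<Rightarrow> real) set" where
  "orthocomplement n k u = {x. (\<forall>i<k. dot n (u i) x = 0) \<and> (\<forall>a\<ge>n. x a = 0)}"

lemma continuous_on_dot:
  assumes "\<And>a. continuous_on S (\<lambda>x. f x a)" "\<And>a. continuous_on S (\<lambda>x. g x a)"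
  shows "continuous_on S (\<lambda>x. dot n (f x) (g x))"
  unfolding dot_def by (intro continuous_intros assms)

lemma continuous_on_coordinate: "continuous_on S (\<lambda>x :: nat \<Rightarrow> real. x a)"
  by (rule continuous_on_subset[OF continuous_on_product_coordinates]) simp

text \<open>
  The sphere is a closed subset of a product of compact intervals.
\<close>

lemma compact_unit_sphere:
  "compact {x \<in> orthocomplement n k u. dot n x x = 1}"
proof -
  let ?B = "PiE UNIV (\<lambda>a. if a < n then {-1..1::real} else {0})"
  let ?C = "(\<Inter>i\<in>{..<k}. {x. dot n (u i) x = 0}) \<inter> {x. dot n x x = 1}"
  have "compactin (product_topology (\<lambda>i. euclidean) UNIV) ?B"
    unfolding compactin_PiE by simp
  then have B: "compact ?B"
    by (simp add: euclidean_product_topology)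
  have C: "closed ?C"
    by (intro closed_Int closed_INT ballI closed_Collect_eq continuous_on_dot continuous_on_coordinate
        continuous_intros)
  have "{x \<in> orthocomplement n k u. dot n x x = 1} = ?B \<inter> ?C"
  proof (intro Set.set_eqI iffI)
    fix x assume x: "x \<in> {x \<in> orthocomplement n k u. dot n x x = 1}"
    have "x a \<in> {-1..1}" if "a < n" for a
    proof -
      have "x a * x a \<le> dot n x x"
        unfolding dot_def using that by (intro member_le_sum) auto
      then have "(x a)\<^sup>2 \<le> 1" using x by (simp add: power2_eq_square)
      then show ?thesis by (simp add: abs_square_le_1 abs_le_iff)
    qed
    with x show "x \<in> ?B \<inter> ?C" by (auto simp: orthocomplement_def PiE_UNIV_domain not_less)
  next
    fix x assume "x \<in> ?B \<inter> ?C"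
    then show "x \<in> {x \<in> orthocomplement n k u. dot n x x = 1}"
      by (simp add: orthocomplement_def PiE_UNIV_domain Pi_iff) (metis not_less singletonD)
  qed
  with compact_Int_closed[OF B C] show ?thesis by simp
qed

text \<open>
  A quadratic function without constant term and bounded above by zero has no linear term; this is
  the first-order condition at a maximum.
\<close>

lemma linear_term_zero:
  fixes c d :: real
  assumes "\<And>t. c * t \<le> d * t\<^sup>2"
  shows "c = 0"
proof (rule ccontr)
  assume c: "c \<noteq> 0"
  let ?t = "c / (\<bar>d\<bar> + 1)"
  have "c * ?t \<le> d * ?t\<^sup>2" by (rule assms)
  also have "\<dots> \<le> \<bar>d\<bar> * ?t\<^sup>2" by (intro mult_right_mono) auto
  also have "\<dots> < (\<bar>d\<bar> + 1) * ?t\<^sup>2" using c by (intro mult_strict_right_mono) (auto simp: add_eq_0_iff)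
  also have "\<dots> = c * ?t" by (simp add: power2_eq_square)
  finally show False by simp
qed

lemma orthocomplement_scale: "x \<in> orthocomplement n k u \<Longrightarrow> (\<lambda>a. c * x a) \<in> orthocomplement n k u"
  and orthocomplement_add: "x \<in> orthocomplement n k u \<Longrightarrow> y \<in> orthocomplement n k u
    \<Longrightarrow> (\<lambda>a. x a + y a) \<in> orthocomplement n k u"
  and orthocomplement_diff: "x \<in> orthocomplement n k u \<Longrightarrow> y \<in> orthocomplement n k u
    \<Longrightarrow> (\<lambda>a. x a - y a) \<in> orthocomplement n k u"
  by (simp_all add: orthocomplement_def dot_scale_right dot_add_right dot_diff_right)

text \<open>
  A maximizer \<open>x\<close> of the quadratic form on the unit sphere of the orthogonal complement \<open>W\<close> is an
  eigenvector, the eigenvalue being the maximum \<open>m\<close>. By scaling, the form is at most \<open>m\<close> times the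
  squared length on all of \<open>W\<close>, with equality at \<open>x\<close>; comparing the terms of first order along
  \<open>x + t y\<close> shows that \<open>A x - m x\<close> is orthogonal to every \<open>y\<close> in \<open>W\<close>. But \<open>W\<close> is invariant
  under the symmetric \<open>A\<close>, since the family spanning its complement consists of eigenvectors, so
  \<open>A x - m x\<close> lies in \<open>W\<close> itself and must vanish.
\<close>

lemma eigenvector_in_orthocomplement:
  assumes sym: "\<And>a b. a < n \<Longrightarrow> b < n \<Longrightarrow> A a b = A b a"
    and u: "orthonormal n k u" and supp: "\<And>i a. i < k \<Longrightarrow> n \<le> a \<Longrightarrow> u i a = 0"
    and eig: "\<And>i. i < k \<Longrightarrow> apply_mat n A (u i) = (\<lambda>a. l i * u i a)" and "k < n"
  obtains x m where "x \<in> orthocomplement n k u" "dot n x x = 1" "apply_mat n A x = (\<lambda>a. m * x a)"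
proof -
  define W where "W = orthocomplement n k u"
  define S where "S = {x \<in> W. dot n x x = 1}"
  define q where "q x = dot n x (apply_mat n A x)" for x
  have "compact S" unfolding S_def W_def by (rule compact_unit_sphere)
  moreover have "S \<noteq> {}"
    by (rule orthonormal_extend[OF u supp \<open>k < n\<close>]) (auto simp: S_def W_def orthocomplement_def)
  moreover have "continuous_on S q"
    unfolding q_def dot_apply_mat by (intro continuous_intros continuous_on_coordinate)
  ultimately obtain x where x: "x \<in> S" and max: "\<And>y. y \<in> S \<Longrightarrow> q y \<le> q x"
    using continuous_attains_sup by metis
  define m where "m = q x"
  have xW: "x \<in> W" and xx: "dot n x x = 1" using x by (auto simp: S_def)
  have bound: "q y \<le> m * dot n y y" if "y \<in> W" for y
  proof (cases "dot n y y = 0")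
    case True
    then have "q y = 0" by (simp add: q_def dot_def dot_self_eq_0D[OF True])
    with True show ?thesis by simp
  next
    case False
    then have pos: "0 < dot n y y" using dot_self_nonneg[of n y] by linarith
    define c where "c = 1 / sqrt (dot n y y)"
    have cc: "c * c * dot n y y = 1" using pos by (simp add: c_def field_simps)
    have "(\<lambda>a. c * y a) \<in> S"
      using that cc by (simp add: S_def W_def orthocomplement_scale dot_scale_left dot_scale_right mult.assoc)
    from max[OF this] have "c * c * q y \<le> m"
      by (simp add: q_def m_def apply_mat_scale dot_scale_left dot_scale_right mult.assoc)
    then have "c * c * q y * dot n y y \<le> m * dot n y y" using pos by (intro mult_right_mono) auto
    moreover have "c * c * q y * dot n y y = q y" using cc by (simp add: mult_ac)
    ultimately show ?thesis by simp
  qed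
  have first_order: "dot n y (\<lambda>a. apply_mat n A x a - m * x a) = 0" if y: "y \<in> W" for y
  proof -
    \<comment> \<open>The bound at the vector with coordinates x + t y, where the constant terms cancel.\<close>
    have "(2 * dot n y (\<lambda>a. apply_mat n A x a - m * x a)) * t \<le> (m * dot n y y - q y) * t\<^sup>2" for t
    proof -
      have "(\<lambda>a. x a + t * y a) \<in> W"
        using xW y by (simp add: W_def orthocomplement_add orthocomplement_scale)
      from bound[OF this]
      have "q x + t * dot n x (apply_mat n A y) + t * dot n y (apply_mat n A x) + t * t * q y
          \<le> m * (dot n x x + t * dot n x y + t * dot n y x + t * t * dot n y y)"
        by (simp add: q_def apply_mat_add apply_mat_scale dot_add_left dot_add_right dot_scale_left
            dot_scale_right algebra_simps)
      moreover have "dot n x (apply_mat n A y) = dot n y (apply_mat n A x)"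
        by (subst dot_apply_mat_symmetric[OF sym], assumption+) (rule dot_commute)
      ultimately show ?thesis
        using xx by (simp add: m_def dot_diff_right dot_scale_right dot_commute[of n x y]
            algebra_simps power2_eq_square)
    qed
    from linear_term_zero[OF this] show ?thesis by simp
  qed
  define z where "z = (\<lambda>a. apply_mat n A x a - m * x a)"
  have "dot n (u i) (apply_mat n A x) = 0" if "i < k" for i
  proof -
    have "dot n (u i) (apply_mat n A x) = dot n (apply_mat n A (u i)) x"
      by (rule dot_apply_mat_symmetric[OF sym])
    also have "\<dots> = l i * dot n (u i) x"
      by (simp only: eig[OF that] dot_scale_left)
    finally show ?thesis using xW that by (simp add: W_def orthocomplement_def)
  qed
  then have "apply_mat n A x \<in> W"
    by (simp add: W_def orthocomplement_def) (simp add: apply_mat_def)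
  then have zW: "z \<in> W"
    unfolding z_def W_def using xW
    by (intro orthocomplement_diff orthocomplement_scale) (simp_all add: W_def)
  with first_order have "dot n z z = 0" by (simp add: z_def)
  then have "z a = 0" for a
    using zW dot_self_eq_0D[of n z a] by (cases "a < n") (auto simp: W_def orthocomplement_def)
  then have "apply_mat n A x = (\<lambda>a. m * x a)" by (auto simp: z_def fun_eq_iff)
  with xW xx show thesis by (intro that) (auto simp: W_def)
qed

lemma orthonormal_eigenvectors:
  assumes sym: "\<And>a b. a < n \<Longrightarrow> b < n \<Longrightarrow> A a b = A b a" and "k \<le> n"
  shows "\<exists>u l. orthonormal n k u \<and> (\<forall>i<k. \<forall>a\<ge>n. u i a = 0)
    \<and> (\<forall>i<k. apply_mat n A (u i) = (\<lambda>a. l i * u i a))"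
  using \<open>k \<le> n\<close>
proof (induction k)
  case 0
  then show ?case by (simp add: orthonormal_def)
next
  case (Suc k)
  then obtain u l where u: "orthonormal n k u" "\<And>i a. i < k \<Longrightarrow> n \<le> a \<Longrightarrow> u i a = 0"
    and eig: "\<And>i. i < k \<Longrightarrow> apply_mat n A (u i) = (\<lambda>a. l i * u i a)"
    by auto
  from eigenvector_in_orthocomplement[OF sym u eig] Suc.prems obtain x m where
    x: "x \<in> orthocomplement n k u" "dot n x x = 1" "apply_mat n A x = (\<lambda>a. m * x a)"
    by auto
  have "orthonormal n (Suc k) (u(k := x))"
    using u(1) x(1,2) by (auto simp: orthonormal_def less_Suc_eq orthocomplement_def dot_commute[of n x "u _"])
  moreover have "\<forall>i<Suc k. apply_mat n A ((u(k := x)) i) = (\<lambda>a. (l(k := m)) i * (u(k := x)) i a)"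
    using eig x(3) by (auto simp: less_Suc_eq)
  moreover have "\<forall>i<Suc k. \<forall>a\<ge>n. (u(k := x)) i a = 0"
    using u(2) x(1) by (auto simp: less_Suc_eq orthocomplement_def)
  ultimately show ?case by blast
qed

text \<open>
  For a square matrix, orthonormal rows imply orthonormal columns.
\<close>

lemma orthonormal_complete:
  assumes u: "orthonormal n n u" and "a < n" "b < n"
  shows "(\<Sum>i<n. u i a * u i b) = (if a = b then 1 else 0)"
proof -
  let ?U = "mat n n (\<lambda>(i, a). u i a)" and ?V = "mat n n (\<lambda>(a, i). u i a)"
  have "?U * ?V = 1\<^sub>m n"
    by (rule eq_matI)
      (auto simp: scalar_prod_def orthonormalD[OF u, unfolded dot_def] atLeast0LessThan)
  then have "?V * ?U = 1\<^sub>m n"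
    by (rule mat_mult_left_right_inverse[rotated 2]) auto
  then have "(?V * ?U) $$ (a, b) = 1\<^sub>m n $$ (a, b)"
    by simp
  then show ?thesis
    using assms(2,3) by (simp add: scalar_prod_def atLeast0LessThan split: if_splits)
qed

text \<open>
  Once the eigenvectors form a basis, inserting the identity matrix in the form of the completeness
  relation \<open>orthonormal_complete\<close> after \<open>A\<close> turns their eigenvector equations into the expansion.
\<close>

theorem spectral_decomposition:
  assumes sym: "\<And>a b. a < n \<Longrightarrow> b < n \<Longrightarrow> A a b = A b a"
  obtains u l where "orthonormal n n u"
    "\<And>a b. a < n \<Longrightarrow> b < n \<Longrightarrow> A a b = (\<Sum>i<n. l i * u i a * u i b)"
proof -
  from orthonormal_eigenvectors[of n A n, OF sym] obtain u l where u: "orthonormal n n u"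
    and eig: "\<And>i. i < n \<Longrightarrow> apply_mat n A (u i) = (\<lambda>a. l i * u i a)"
    by blast
  show thesis
  proof (rule that[OF u])
    fix a b assume ab: "a < n" "b < n"
    have "A a b = (\<Sum>c<n. if c = b then A a c else 0)"
      using ab by simp
    also have "\<dots> = (\<Sum>c<n. A a c * (\<Sum>i<n. u i c * u i b))"
      by (intro sum.cong refl) (simp add: orthonormal_complete[OF u] ab)
    also have "\<dots> = (\<Sum>c<n. \<Sum>i<n. A a c * u i c * u i b)"
      by (simp add: sum_distrib_left mult.assoc)
    also have "\<dots> = (\<Sum>i<n. \<Sum>c<n. A a c * u i c * u i b)"
      by (rule sum.swap)
    also have "\<dots> = (\<Sum>i<n. apply_mat n A (u i) a * u i b)"
      using ab by (simp add: apply_mat_def sum_distrib_right)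
    also have "\<dots> = (\<Sum>i<n. l i * u i a * u i b)"
      by (intro sum.cong refl) (simp add: eig)
    finally show "A a b = (\<Sum>i<n. l i * u i a * u i b)" .
  qed
qed

text \<open>
  The decomposition exhibits the matrix as similar to the diagonal matrix of the \<open>l i\<close>.
\<close>

lemma proots_char_poly_spectral:
  assumes u: "orthonormal n n u"
    and A: "\<And>a b. a < n \<Longrightarrow> b < n \<Longrightarrow> A a b = (\<Sum>i<n. l i * u i a * u i b)"
  shows "proots (char_poly (mat n n (\<lambda>(a, b). A a b))) = mset (map l [0..<n])"
proof -
  let ?A = "mat n n (\<lambda>(a, b). A a b)"
  let ?U = "mat n n (\<lambda>(i, a). u i a)" and ?V = "mat n n (\<lambda>(a, i). u i a)"
  have UV: "?U * ?V = 1\<^sub>m n"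
    by (rule eq_matI)
      (auto simp: scalar_prod_def orthonormalD[OF u, unfolded dot_def] atLeast0LessThan)
  have VU: "?V * ?U = 1\<^sub>m n"
    by (rule eq_matI) (auto simp: scalar_prod_def orthonormal_complete[OF u] atLeast0LessThan)
  have VD: "?V * mat_diag n l = mat n n (\<lambda>(a, i). u i a * l i)"
    by (subst mat_diag_mult_right[of _ n]) (auto intro!: eq_matI)
  have decomp: "?A = ?V * mat_diag n l * ?U"
    unfolding VD by (rule eq_matI) (auto simp: scalar_prod_def atLeast0LessThan A mult_ac)
  have "{?A, mat_diag n l, ?V, ?U} \<subseteq> carrier_mat n n"
    by simp
  from this VU UV decomp have "similar_mat ?A (mat_diag n l)"
    by (rule similar_matI)
  then have "char_poly ?A = char_poly (mat_diag n l)"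
    by (rule char_poly_similar)
  also have "\<dots> = (\<Prod>a\<leftarrow>diag_mat (mat_diag n l). [:- a, 1:])"
    by (rule char_poly_upper_triangular[of _ n]) (auto simp: mat_diag_def)
  also have "diag_mat (mat_diag n l) = map l [0..<n]"
    by (auto simp: diag_mat_def mat_diag_def)
  finally have "char_poly ?A = prod_list (map (\<lambda>a. [:- a, 1:]) (map l [0..<n]))" .
  moreover have "proots (prod_list (map (\<lambda>a. [:- a, 1:]) xs)) = mset xs" for xs :: "real list"
  proof (induction xs)
    case (Cons a xs)
    have "prod_list (map (\<lambda>a. [:- a, 1:]) xs) \<noteq> 0"
      by (auto simp: prod_list_zero_iff)
    with Cons show ?case by (simp add: proots_mult del: mult_pCons_left)
  qed simp
  ultimately show ?thesis by (simp only:)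
qed

section \<open>Ky Fan's inequality\<close>

lemma sort_map_sort_key: "sort (map f xs) = map f (sort_key f xs)"
  by (rule properties_for_sort) simp_all

text \<open>
  Weights between 0 and 1 of total mass \<open>r\<close> do best when they sit on the \<open>r\<close> largest entries.
  Subtracting the \<open>r\<close>-th largest entry from all entries makes this a termwise comparison: the
  first \<open>r\<close> differences are nonnegative and the others are not positive.
\<close>

lemma sum_le_sum_take_desc:
  fixes xs :: "real list" and c :: "nat \<Rightarrow> real"
  assumes sorted: "sorted (rev xs)" and "r \<le> length xs"
    and c: "\<And>i. i < length xs \<Longrightarrow> 0 \<le> c i" "\<And>i. i < length xs \<Longrightarrow> c i \<le> 1"
    and total: "(\<Sum>i<length xs. c i) = real r"
  shows "(\<Sum>i<length xs. xs ! i * c i) \<le> (\<Sum>i<r. xs ! i)"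
proof (cases "r = 0")
  case True
  with total c(1) have "c i = 0" if "i < length xs" for i
    using that sum_nonneg_eq_0_iff[of "{..<length xs}" c] by auto
  with True show ?thesis by simp
next
  case False
  \<comment> \<open>The smallest of the first r entries; the index is meaningful since r is positive.\<close>
  let ?n = "length xs" and ?m = "xs ! (r - 1)"
  have desc: "xs ! j \<le> xs ! i" if "i \<le> j" "j < ?n" for i j
    using sorted that by (simp add: sorted_rev_iff_nth_mono)
  have "(\<Sum>i<?n. (xs ! i - ?m) * c i) \<le> (\<Sum>i<?n. if i < r then xs ! i - ?m else 0)"
  proof (rule sum_mono)
    fix i assume "i \<in> {..<?n}"
    then have i: "i < ?n" by simp
    show "(xs ! i - ?m) * c i \<le> (if i < r then xs ! i - ?m else 0)"
    proof (cases "i < r")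
      case True
      then have "?m \<le> xs ! i" using \<open>r \<le> ?n\<close> by (intro desc) auto
      then have "(xs ! i - ?m) * c i \<le> (xs ! i - ?m) * 1"
        using c(2)[OF i] by (intro mult_left_mono) auto
      with True show ?thesis by simp
    next
      case False
      then have "xs ! i \<le> ?m" using i \<open>r \<noteq> 0\<close> by (intro desc) auto
      with False c(1)[OF i] show ?thesis by (simp add: mult_nonpos_nonneg)
    qed
  qed
  also have "\<dots> = (\<Sum>i<r. xs ! i - ?m)"
    using \<open>r \<le> ?n\<close> by (intro sum.mono_neutral_cong_right) auto
  finally show ?thesis
    using total by (simp add: left_diff_distrib sum_subtractf flip: sum_distrib_left)
qed

text \<open>
  In an orthonormal eigenbasis, the sum of the quadratic form over the \<open>y k\<close> is a weighted sum of
  the eigenvalues. The weight of an eigenvector \<open>u i\<close> is the squared length of its projection to the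
  span of the \<open>y k\<close>, hence at most 1 by Bessel's inequality, and the weights add up to \<open>r\<close> by
  Parseval's identity.
\<close>

theorem ky_fan_inequality:
  assumes sym: "\<And>a b. a < n \<Longrightarrow> b < n \<Longrightarrow> A a b = A b a"
    and y: "orthonormal n r y" and "r \<le> n"
  shows "(\<Sum>k<r. dot n (y k) (apply_mat n A (y k)))
    \<le> (\<Sum>i<r. eigenvalues_desc (mat n n (\<lambda>(a, b). A a b)) ! i)"
proof -
  from spectral_decomposition[of n A, OF sym] obtain u l where u: "orthonormal n n u"
    and A: "\<And>a b. a < n \<Longrightarrow> b < n \<Longrightarrow> A a b = (\<Sum>i<n. l i * u i a * u i b)"
    by blast
  \<comment> \<open>Orders the eigenvectors by nonincreasing eigenvalue.\<close>
  define s where "s = rev (sort_key l [0..<n])"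
  define es where "es = eigenvalues_desc (mat n n (\<lambda>(a, b). A a b))"
  have "proots (char_poly (mat n n (\<lambda>(a, b). A a b))) = mset (map l [0..<n])"
    by (rule proots_char_poly_spectral[OF u]) (rule A)
  then have es: "es = map l s"
    by (simp add: es_def eigenvalues_desc_def s_def sort_map_sort_key rev_map del: mset_map)
  have len: "length s = n" by (simp add: s_def)
  have perm: "bij_betw ((!) s) {..<n} {..<n}"
    by (rule bij_betw_nth) (auto simp: s_def)
  define c where "c i = (\<Sum>k<r. (dot n (y k) (u i))\<^sup>2)" for i
  have quadratic: "dot n x (apply_mat n A x) = (\<Sum>i<n. l i * (dot n x (u i))\<^sup>2)" for x
  proof -
    have "dot n x (apply_mat n A x) = (\<Sum>a<n. \<Sum>b<n. \<Sum>i<n. l i * (x a * u i a) * (x b * u i b))"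
      unfolding dot_apply_mat by (intro sum.cong refl) (simp add: A sum_distrib_left sum_distrib_right mult_ac)
    also have "\<dots> = (\<Sum>a<n. \<Sum>i<n. \<Sum>b<n. l i * (x a * u i a) * (x b * u i b))"
      by (intro sum.cong refl sum.swap)
    also have "\<dots> = (\<Sum>i<n. \<Sum>a<n. \<Sum>b<n. l i * (x a * u i a) * (x b * u i b))"
      by (rule sum.swap)
    also have "\<dots> = (\<Sum>i<n. l i * (dot n x (u i))\<^sup>2)"
      by (simp add: dot_def power2_eq_square sum_product sum_distrib_left mult_ac)
    finally show ?thesis .
  qed
  have parseval: "(\<Sum>i<n. (dot n x (u i))\<^sup>2) = dot n x x" for x
  proof -
    have "(\<Sum>i<n. (dot n x (u i))\<^sup>2) = (\<Sum>i<n. \<Sum>a<n. \<Sum>b<n. (x a * x b) * (u i a * u i b))"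
      by (simp add: dot_def power2_eq_square sum_product mult_ac)
    also have "\<dots> = (\<Sum>a<n. \<Sum>i<n. \<Sum>b<n. (x a * x b) * (u i a * u i b))"
      by (rule sum.swap)
    also have "\<dots> = (\<Sum>a<n. \<Sum>b<n. \<Sum>i<n. (x a * x b) * (u i a * u i b))"
      by (intro sum.cong refl sum.swap)
    also have "\<dots> = (\<Sum>a<n. \<Sum>b<n. if a = b then x a * x b else 0)"
      by (intro sum.cong refl) (simp add: orthonormal_complete[OF u] flip: sum_distrib_left)
    also have "\<dots> = dot n x x" by (simp add: dot_def)
    finally show ?thesis .
  qed
  have "(\<Sum>k<r. dot n (y k) (apply_mat n A (y k))) = (\<Sum>i<n. l i * c i)"
    unfolding quadratic c_def sum_distrib_left by (rule sum.swap)
  also have "\<dots> = (\<Sum>i<n. es ! i * c (s ! i))"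
    by (subst sum.reindex_bij_betw[OF perm, symmetric]) (simp add: es len)
  also have "\<dots> \<le> (\<Sum>i<r. es ! i)"
  proof (rule sum_le_sum_take_desc[of es r "\<lambda>i. c (s ! i)", simplified es length_map len, folded es])
    show "sorted (rev es)"
      by (simp add: es_def eigenvalues_desc_def)
    show "0 \<le> c (s ! i)" for i
      by (simp add: c_def sum_nonneg)
    show "c (s ! i) \<le> 1" if "i < n" for i
    proof -
      have "s ! i < n" using perm that by (auto dest: bij_betwE)
      with bessel_inequality[OF y, of "u (s ! i)"] show ?thesis
        by (simp add: c_def orthonormalD[OF u])
    qed
    have "(\<Sum>i<n. c (s ! i)) = (\<Sum>i<n. c i)"
      by (rule sum.reindex_bij_betw[OF perm])
    also have "\<dots> = (\<Sum>k<r. dot n (y k) (y k))"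
      unfolding c_def parseval[symmetric] by (rule sum.swap)
    finally show "(\<Sum>i<n. c (s ! i)) = real r"
      by (simp add: orthonormalD[OF y])
  qed (fact \<open>r \<le> n\<close>)
  finally show ?thesis by (simp add: es_def)
qed

section \<open>Laplacians of weighted complete graphs\<close>

text \<open>
  A weight on the diagonal enters the row sum and is subtracted again, so the matrix depends only on
  the weights of pairs of distinct indices.
\<close>

definition weighted_laplacian :: "nat \<Rightarrow> (nat \<Rightarrow> nat \<Rightarrow> real) \<Rightarrow> nat \<Rightarrow> nat \<Rightarrow> real" where
  "weighted_laplacian n d a b = (if a = b then \<Sum>c<n. d a c else 0) - d a b"

lemma weighted_laplacian_quadratic_form:
  assumes sym: "\<And>a b. a < n \<Longrightarrow> b < n \<Longrightarrow> d a b = d b a"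
  shows "2 * dot n x (apply_mat n (weighted_laplacian n d) x)
    = (\<Sum>a<n. \<Sum>b<n. d a b * (x a - x b)\<^sup>2)"
proof -
  have "(\<Sum>b<n. weighted_laplacian n d a b * x a * x b)
      = (\<Sum>b<n. d a b * (x a)\<^sup>2) - (\<Sum>b<n. d a b * x a * x b)" if "a < n" for a
  proof -
    have "(\<Sum>b<n. weighted_laplacian n d a b * x a * x b)
        = (\<Sum>b<n. (if a = b then (\<Sum>c<n. d a c) * x a * x b else 0) - d a b * x a * x b)"
      by (intro sum.cong refl) (simp add: weighted_laplacian_def algebra_simps)
    also have "\<dots> = (\<Sum>c<n. d a c) * (x a)\<^sup>2 - (\<Sum>b<n. d a b * x a * x b)"
      using that by (simp add: sum_subtractf power2_eq_square mult.assoc)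
    finally show ?thesis by (simp add: sum_distrib_right)
  qed
  then have form: "dot n x (apply_mat n (weighted_laplacian n d) x)
      = (\<Sum>a<n. \<Sum>b<n. d a b * (x a)\<^sup>2) - (\<Sum>a<n. \<Sum>b<n. d a b * x a * x b)"
    unfolding dot_apply_mat by (simp add: sum_subtractf)
  have swap: "(\<Sum>a<n. \<Sum>b<n. d a b * (x b)\<^sup>2) = (\<Sum>a<n. \<Sum>b<n. d a b * (x a)\<^sup>2)"
    by (subst sum.swap) (intro sum.cong refl, simp add: sym)
  have "(\<Sum>a<n. \<Sum>b<n. d a b * (x a - x b)\<^sup>2)
      = (\<Sum>a<n. \<Sum>b<n. d a b * (x a)\<^sup>2 + d a b * (x b)\<^sup>2 - 2 * (d a b * x a * x b))"
    by (intro sum.cong refl) (simp add: power2_eq_square algebra_simps)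
  also have "\<dots> = 2 * ((\<Sum>a<n. \<Sum>b<n. d a b * (x a)\<^sup>2) - (\<Sum>a<n. \<Sum>b<n. d a b * x a * x b))"
    by (simp add: sum_subtractf sum.distrib swap flip: sum_distrib_left)
  finally show ?thesis unfolding form by simp
qed

lemma sum_pairwise_square_diff:
  fixes x :: "'a \<Rightarrow> real"
  shows "(\<Sum>a\<in>S. \<Sum>b\<in>S. (x a - x b)\<^sup>2) = 2 * real (card S) * (\<Sum>a\<in>S. (x a)\<^sup>2) - 2 * (\<Sum>a\<in>S. x a)\<^sup>2"
proof -
  have "(\<Sum>a\<in>S. \<Sum>b\<in>S. (x a - x b)\<^sup>2)
      = (\<Sum>a\<in>S. \<Sum>b\<in>S. (x a)\<^sup>2 + (x b)\<^sup>2 - 2 * (x a * x b))"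
    by (simp add: power2_eq_square algebra_simps)
  also have "\<dots> = 2 * real (card S) * (\<Sum>a\<in>S. (x a)\<^sup>2) - 2 * (\<Sum>a\<in>S. \<Sum>b\<in>S. x a * x b)"
    by (simp add: sum.distrib sum_subtractf flip: sum_distrib_left)
  also have "(\<Sum>a\<in>S. \<Sum>b\<in>S. x a * x b) = (\<Sum>a\<in>S. x a)\<^sup>2"
    by (simp add: power2_eq_square sum_product)
  finally show ?thesis .
qed

definition cell :: "nat \<Rightarrow> (nat \<Rightarrow> 'c) \<Rightarrow> 'c \<Rightarrow> nat set" where
  "cell n cl c = {a. a < n \<and> cl a = c}"

lemma finite_cell [simp]: "finite (cell n cl c)"
  by (simp add: cell_def)

text \<open>
  Lowering the weights to 2 inside the cell of \<open>c\<close> and to 1 elsewhere can only decrease the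
  quadratic form, a sum of nonnegative terms. For the lowered weights the form is computed exactly:
  a vector of sum zero supported in the cell receives \<open>n\<close> times its squared length from the
  uniform weight 1, and the size of the cell times its squared length from the additional weight 1
  inside that cell.
\<close>

lemma laplacian_bound_on_cell:
  assumes sym: "\<And>a b. a < n \<Longrightarrow> b < n \<Longrightarrow> d a b = d b a"
    and one: "\<And>a b. a < n \<Longrightarrow> b < n \<Longrightarrow> a \<noteq> b \<Longrightarrow> 1 \<le> d a b"
    and two: "\<And>a b. a < n \<Longrightarrow> b < n \<Longrightarrow> a \<noteq> b \<Longrightarrow> cl a = cl b \<Longrightarrow> 2 \<le> d a b"
    and supp: "\<And>a. a < n \<Longrightarrow> cl a \<noteq> c \<Longrightarrow> x a = 0" and zero: "(\<Sum>a<n. x a) = 0"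
  shows "(real n + real (card (cell n cl c))) * dot n x x
    \<le> dot n x (apply_mat n (weighted_laplacian n d) x)"
proof -
  let ?C = "cell n cl c"
  have to_cell: "(\<Sum>a\<in>?C. f a) = (\<Sum>a<n. f a)" if "\<And>a. a < n \<Longrightarrow> cl a \<noteq> c \<Longrightarrow> f a = 0" for f :: "nat \<Rightarrow> real"
    using that by (intro sum.mono_neutral_left) (auto simp: cell_def)
  have sq: "(\<Sum>a\<in>?C. (x a)\<^sup>2) = dot n x x"
    by (subst to_cell) (auto simp: supp dot_def power2_eq_square)
  have "(\<Sum>a<n. \<Sum>b<n. (x a - x b)\<^sup>2) = 2 * real n * dot n x x"
    unfolding sum_pairwise_square_diff zero by (simp add: dot_def power2_eq_square)
  moreover have "(\<Sum>a<n. \<Sum>b<n. of_bool (cl a = c \<and> cl b = c) * (x a - x b)\<^sup>2) = 2 * real (card ?C) * dot n x x"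
  proof -
    have "(\<Sum>a<n. \<Sum>b<n. of_bool (cl a = c \<and> cl b = c) * (x a - x b)\<^sup>2)
        = (\<Sum>a\<in>?C. \<Sum>b<n. of_bool (cl a = c \<and> cl b = c) * (x a - x b)\<^sup>2)"
      by (rule to_cell[symmetric]) simp
    also have "\<dots> = (\<Sum>a\<in>?C. \<Sum>b\<in>?C. of_bool (cl a = c \<and> cl b = c) * (x a - x b)\<^sup>2)"
      by (intro sum.cong refl to_cell[symmetric]) simp
    also have "\<dots> = (\<Sum>a\<in>?C. \<Sum>b\<in>?C. (x a - x b)\<^sup>2)"
      by (intro sum.cong refl) (simp add: cell_def)
    also have "\<dots> = 2 * real (card ?C) * dot n x x"
      unfolding sum_pairwise_square_diff sq using zero by (subst to_cell) (simp_all add: supp)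
    finally show ?thesis .
  qed
  ultimately have "2 * ((real n + real (card ?C)) * dot n x x)
      = (\<Sum>a<n. \<Sum>b<n. (1 + of_bool (cl a = c \<and> cl b = c)) * (x a - x b)\<^sup>2)"
    by (simp add: distrib_right sum.distrib)
  also have "\<dots> \<le> (\<Sum>a<n. \<Sum>b<n. d a b * (x a - x b)\<^sup>2)"
  proof (intro sum_mono)
    fix a b assume "a \<in> {..<n}" "b \<in> {..<n}"
    then have "a \<noteq> b \<Longrightarrow> 1 + of_bool (cl a = c \<and> cl b = c) \<le> d a b"
      using one[of a b] two[of a b] by auto
    then show "(1 + of_bool (cl a = c \<and> cl b = c)) * (x a - x b)\<^sup>2 \<le> d a b * (x a - x b)\<^sup>2"
      by (cases "a = b") (simp, intro mult_right_mono, simp_all)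
  qed
  also have "\<dots> = 2 * dot n x (apply_mat n (weighted_laplacian n d) x)"
    by (rule weighted_laplacian_quadratic_form[symmetric]) (rule sym)
  finally show ?thesis by simp
qed

section \<open>Helmert contrasts\<close>

text \<open>
  Every element of a cell except the least one has a nonempty set of earlier elements. These
  elements index the test vectors: one less per cell than its size, as many as the dimension of the
  space of vectors of sum zero on the cell.
\<close>

definition earlier :: "(nat \<Rightarrow> 'c) \<Rightarrow> nat \<Rightarrow> nat set" where
  "earlier cl a = {b. b < a \<and> cl b = cl a}"

text \<open>
  The Helmert contrast that compares the element \<open>a\<close> with the mean of the earlier elements of its
  cell. For the elements of a cell other than its first, these are the nonconstant rows of the
  Helmert matrix, an explicit orthonormal basis of the vectors of sum zero; at the first element
  the formula gives the zero vector.
\<close>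

definition helmert :: "(nat \<Rightarrow> 'c) \<Rightarrow> nat \<Rightarrow> nat \<Rightarrow> real" where
  "helmert cl a b = (let k = real (card (earlier cl a)) in
     (if b \<in> earlier cl a then 1 else if b = a then - k else 0) / sqrt (k * (k + 1)))"

lemma finite_earlier [simp]: "finite (earlier cl a)"
  by (simp add: earlier_def)

lemma sum_over_earlier:
  fixes s t :: real
  assumes "a < n"
  shows "(\<Sum>b<n. if b \<in> earlier cl a then s else if b = a then t else 0)
    = real (card (earlier cl a)) * s + t"
proof -
  have "(\<Sum>b<n. if b \<in> earlier cl a then s else if b = a then t else 0)
      = (\<Sum>b\<in>insert a (earlier cl a). if b \<in> earlier cl a then s else if b = a then t else 0)"
    using assms by (intro sum.mono_neutral_right) (auto simp: earlier_def)
  also have "\<dots> = t + (\<Sum>b\<in>earlier cl a. s)"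
    by (subst sum.insert) (auto simp: earlier_def)
  finally show ?thesis by simp
qed

lemma helmert_support: "cl b \<noteq> cl a \<Longrightarrow> helmert cl a b = 0"
  by (auto simp: helmert_def earlier_def Let_def)

lemma sum_helmert:
  assumes "a < n"
  shows "(\<Sum>b<n. helmert cl a b) = 0"
  unfolding helmert_def Let_def sum_divide_distrib[symmetric] sum_over_earlier[OF assms] by simp

lemma dot_helmert_self:
  assumes "a < n" "earlier cl a \<noteq> {}"
  shows "dot n (helmert cl a) (helmert cl a) = 1"
proof -
  define k where "k = real (card (earlier cl a))"
  have k: "0 < k" using assms(2) by (simp add: k_def card_gt_0_iff)
  have "dot n (helmert cl a) (helmert cl a)
      = (\<Sum>b<n. (if b \<in> earlier cl a then 1 else if b = a then k\<^sup>2 else 0) / (k * (k + 1)))"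
    unfolding dot_def helmert_def Let_def k_def[symmetric] using k
    by (intro sum.cong refl) (auto simp: power2_eq_square)
  also have "\<dots> = (k + k\<^sup>2) / (k * (k + 1))"
    unfolding sum_divide_distrib[symmetric] sum_over_earlier[OF assms(1)] by (simp add: k_def)
  also have "k + k\<^sup>2 = k * (k + 1)"
    by (simp add: power2_eq_square algebra_simps)
  finally show ?thesis using k by simp
qed

text \<open>
  Within one cell, the later contrast is constant on the support of the earlier one, whose
  coordinates add up to zero.
\<close>

lemma dot_helmert_less:
  assumes "a < a'" "a < n"
  shows "dot n (helmert cl a) (helmert cl a') = 0"
proof (cases "cl a = cl a'")
  case True
  \<comment> \<open>The constant value of the later contrast on all elements of its cell before its own index.\<close>
  define t where "t = helmert cl a' a"
  have "helmert cl a b * helmert cl a' b = t * helmert cl a b" for b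
  proof (cases "helmert cl a b = 0")
    case False
    then have "b \<in> insert a (earlier cl a)"
      by (auto simp: helmert_def Let_def split: if_splits)
    then have "b \<in> earlier cl a'" "a \<in> earlier cl a'"
      using assms(1) True by (auto simp: earlier_def)
    then show ?thesis by (simp add: t_def helmert_def)
  qed simp
  then have "dot n (helmert cl a) (helmert cl a') = t * (\<Sum>b<n. helmert cl a b)"
    unfolding dot_def sum_distrib_left by (intro sum.cong refl)
  then show ?thesis by (simp only: sum_helmert[OF assms(2)] mult_zero_right)
next
  case False
  then have "helmert cl a b * helmert cl a' b = 0" for b
    by (metis helmert_support mult_eq_0_iff)
  then show ?thesis by (simp only: dot_def sum.neutral_const)
qed

lemma dot_helmert_distinct:
  assumes "a \<noteq> a'" "a < n" "a' < n"
  shows "dot n (helmert cl a) (helmert cl a') = 0"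
  using assms by (metis dot_commute dot_helmert_less nat_neq_iff)

lemma orthonormal_helmert:
  assumes "distinct as" "\<And>a. a \<in> set as \<Longrightarrow> a < n \<and> earlier cl a \<noteq> {}" "r \<le> length as"
  shows "orthonormal n r (\<lambda>k. helmert cl (as ! k))"
  using assms unfolding orthonormal_def
  by (auto simp: nth_eq_iff_index_eq intro!: dot_helmert_self dot_helmert_distinct)

lemma card_nonfirst_in_cell:
  "card {a \<in> cell n cl c. earlier cl a \<noteq> {}} = card (cell n cl c) - 1"
proof (cases "cell n cl c = {}")
  case False
  let ?m = "Min (cell n cl c)"
  have m: "?m \<in> cell n cl c" "\<And>a. a \<in> cell n cl c \<Longrightarrow> ?m \<le> a"
    using False by auto
  have "{a \<in> cell n cl c. earlier cl a \<noteq> {}} = cell n cl c - {?m}"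
  proof (intro Set.set_eqI iffI)
    fix a assume a: "a \<in> {a \<in> cell n cl c. earlier cl a \<noteq> {}}"
    then obtain b where b: "b < a" "cl b = cl a" by (auto simp: earlier_def)
    with a have "b \<in> cell n cl c" by (auto simp: cell_def)
    with m(2)[of b] b have "?m < a" by linarith
    with a show "a \<in> cell n cl c - {?m}" by blast
  next
    fix a assume a: "a \<in> cell n cl c - {?m}"
    then have "a \<in> cell n cl c" "a \<noteq> ?m" by blast+
    with m(2)[of a] have "?m < a" by linarith
    moreover have "cl ?m = cl a" using m(1) a by (simp add: cell_def)
    ultimately have "?m \<in> earlier cl a" by (simp add: earlier_def)
    with a show "a \<in> {a \<in> cell n cl c. earlier cl a \<noteq> {}}" by blast
  qed
  with m(1) show ?thesis by (simp add: card_Diff_singleton)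
qed simp

lemma image_mset_mset_set: "finite S \<Longrightarrow> image_mset g (mset_set S) = (\<Sum>a\<in>S. {#g a#})"
  by (induction rule: finite_induct) auto

text \<open>
  The least elements removed, a cell contributes its value once less often than its size.
\<close>

lemma mset_nonfirst_by_cell:
  "image_mset (\<lambda>a. g (cl a)) (mset_set {a. a < n \<and> earlier cl a \<noteq> {}})
    = (\<Sum>c\<in>cl ` {..<n}. replicate_mset (card (cell n cl c) - 1) (g c))"
proof -
  let ?N = "\<lambda>c. {a \<in> cell n cl c. earlier cl a \<noteq> {}}"
  have N: "{a. a < n \<and> earlier cl a \<noteq> {}} = (\<Union>c\<in>cl ` {..<n}. ?N c)"
    by (auto simp: cell_def)
  have "image_mset (\<lambda>a. g (cl a)) (mset_set {a. a < n \<and> earlier cl a \<noteq> {}})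
      = (\<Sum>a\<in>(\<Union>c\<in>cl ` {..<n}. ?N c). {#g (cl a)#})"
    by (subst image_mset_mset_set) (simp_all add: N)
  also have "\<dots> = (\<Sum>c\<in>cl ` {..<n}. \<Sum>a\<in>?N c. {#g (cl a)#})"
    by (rule sum.UNION_disjoint) (auto simp: cell_def)
  also have "\<dots> = (\<Sum>c\<in>cl ` {..<n}. \<Sum>a\<in>?N c. {#g c#})"
    by (intro sum.cong refl) (auto simp: cell_def)
  also have "\<dots> = (\<Sum>c\<in>cl ` {..<n}. replicate_mset (card (?N c)) (g c))"
    by (intro sum.cong refl)
      (simp add: image_mset_const_eq flip: image_mset_mset_set)
  finally show ?thesis
    by (simp only: card_nonfirst_in_cell)
qed

section \<open>Distances in a connected graph\<close>

text \<open>
  The vertex set is carried through the induction because appending the reversed first arc yields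
  a path only if its new endpoint has not been visited.
\<close>

lemma (in sym_digraph) apath_reverse:
  assumes "apath u p v"
  shows "\<exists>q. apath v q u \<and> length q = length p \<and> set (awalk_verts v q) = set (awalk_verts u p)"
  using assms
proof (induction p arbitrary: u)
  case Nil
  then show ?case by (intro exI[of _ "[]"]) (auto simp: apath_Nil_iff)
next
  case (Cons e es)
  then have e: "e \<in> arcs G" "tail G e = u" and es: "apath (head G e) es v"
    and u: "u \<notin> set (awalk_verts (head G e) es)"
    by (auto simp: apath_Cons_iff)
  from Cons.IH[OF es] obtain q where q: "apath v q (head G e)" "length q = length es"
    "set (awalk_verts v q) = set (awalk_verts (head G e) es)"
    by blast
  from sym_arcs e(1) obtain e' where e': "e' \<in> arcs G" "tail G e' = head G e" "head G e' = u"
    unfolding symmetric_conv using e(2) by metis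
  have last: "awlast v q = head G e"
    using q(1) by (auto simp: apath_def awalk_def)
  have "head G e \<in> set (awalk_verts (head G e) es)"
    using es by (cases es) (auto simp: apath_Cons_iff)
  with u have neq: "head G e \<noteq> u" by metis
  have "u \<in> verts G" using e by auto
  with e' neq have "apath (head G e) [e'] u"
    by (simp add: apath_simps)
  moreover have "set (awalk_verts v q) \<inter> set (tl (awalk_verts (head G e) [e'])) = {}"
    using q(3) u e' by simp
  ultimately have "apath v (q @ [e']) u"
    unfolding apath_append_iff last using q(1) by blast
  moreover have "set (awalk_verts v (q @ [e'])) = set (awalk_verts u (e # es))"
  proof -
    have "awalk v (q @ [e']) u"
      using \<open>apath v (q @ [e']) u\<close> by (rule awalkI_apath)
    then have "awalk_verts v (q @ [e']) = awalk_verts v q @ tl (awalk_verts (head G e) [e'])"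
      by (metis awalk_verts_append last)
    with q(3) e e' show ?thesis by auto
  qed
  ultimately show ?case using q(2) by (intro exI[of _ "q @ [e']"]) simp
qed

lemma (in sym_digraph) graph_dist_commute: "graph_dist G u v = graph_dist G v u"
proof -
  have "(\<exists>p. apath u p v \<and> length p = k) = (\<exists>p. apath v p u \<and> length p = k)" for k
    by (metis apath_reverse)
  then show ?thesis by (simp add: graph_dist_def)
qed

lemma (in sym_digraph) graph_dist_attained:
  assumes "Digraph_Component.connected G" "u \<in> verts G" "v \<in> verts G"
  obtains p where "apath u p v" "length p = graph_dist G u v"
proof -
  have "u \<rightarrow>\<^sup>*\<^bsub>mk_symmetric G\<^esub> v"
    using assms by (auto simp: connected_def)
  then have "u \<rightarrow>\<^sup>* v"
    by (simp add: reachable_mk_symmetric_eq[OF sym_arcs])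
  then obtain p where "apath u p v"
    by (auto simp: reachable_apath)
  then have "\<exists>k p. apath u p v \<and> length p = k"
    by blast
  from LeastI_ex[OF this] that show thesis
    unfolding graph_dist_def by blast
qed

lemma (in sym_digraph) graph_dist_ge_1:
  assumes "Digraph_Component.connected G" "u \<in> verts G" "v \<in> verts G" "u \<noteq> v"
  shows "1 \<le> graph_dist G u v"
proof -
  obtain p where p: "apath u p v" "length p = graph_dist G u v"
    by (rule graph_dist_attained[OF assms(1-3)])
  with assms(4) have "p \<noteq> []" by (auto simp: apath_Nil_iff)
  with p(2) show ?thesis by (cases p) auto
qed

lemma (in sym_digraph) graph_dist_ge_2:
  assumes "Digraph_Component.connected G" "u \<in> verts G" "v \<in> verts G" "u \<noteq> v"
    and "\<not> u \<rightarrow>\<^bsub>G\<^esub> v"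
  shows "2 \<le> graph_dist G u v"
proof -
  obtain p where p: "apath u p v" "length p = graph_dist G u v"
    by (rule graph_dist_attained[OF assms(1-3)])
  have "graph_dist G u v \<noteq> 1"
  proof
    assume "graph_dist G u v = 1"
    with p(2) obtain e where "p = [e]" by (auto simp: length_Suc_conv)
    with p(1) have "e \<in> arcs G" "tail G e = u" "head G e = v"
      by (auto simp: apath_simps)
    with assms(5) show False by (metis in_arcs_imp_in_arcs_ends)
  qed
  with graph_dist_ge_1[OF assms(1-4)] show ?thesis by linarith
qed

text \<open>
  Symmetry of the distance turns the column sum in the transmission into the row sum in the
  weighted Laplacian.
\<close>

lemma (in sym_digraph) distance_laplacian_eq_weighted_laplacian:
  assumes "distinct vs" "set vs = verts G"
  shows "distance_laplacian G vs = mat (length vs) (length vs)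
    (\<lambda>(a, b). weighted_laplacian (length vs) (\<lambda>a b. real (graph_dist G (vs ! a) (vs ! b))) a b)"
proof (rule eq_matI)
  fix a b assume "a < dim_row (mat (length vs) (length vs)
      (\<lambda>(a, b). weighted_laplacian (length vs) (\<lambda>a b. real (graph_dist G (vs ! a) (vs ! b))) a b))"
    "b < dim_col (mat (length vs) (length vs)
      (\<lambda>(a, b). weighted_laplacian (length vs) (\<lambda>a b. real (graph_dist G (vs ! a) (vs ! b))) a b))"
  then have ab: "a < length vs" "b < length vs" by simp_all
  have "bij_betw ((!) vs) {..<length vs} (verts G)"
    using assms by (intro bij_betw_nth) auto
  from sum.reindex_bij_betw[OF this, of "\<lambda>u. graph_dist G u (vs ! a)"]
  have "real (transmission G (vs ! a)) = (\<Sum>c<length vs. real (graph_dist G (vs ! a) (vs ! c)))"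
    by (simp add: transmission_def graph_dist_commute[of "vs ! a"] flip: of_nat_sum)
  with ab show "distance_laplacian G vs $$ (a, b) = mat (length vs) (length vs)
      (\<lambda>(a, b). weighted_laplacian (length vs) (\<lambda>a b. real (graph_dist G (vs ! a) (vs ! b))) a b) $$ (a, b)"
    by (cases "a = b") (simp_all add: distance_laplacian_def distance_matrix_def mat_diag_def weighted_laplacian_def)
qed (simp_all add: distance_laplacian_def distance_matrix_def mat_diag_def)

section \<open>Eigenvalue sums and colorings\<close>

lemma mset_Theta_list:
  "mset (Theta_list n ls) = (\<Sum>l\<in>#mset ls. replicate_mset (l - 1) (n + l))"
  unfolding Theta_list_def by (induction ls) auto

lemma sum_mset_class_sizes:
  "(\<Sum>l\<in>#mset (class_sizes P). g l) = (\<Sum>C\<in>P. g (card C))"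
  by (simp add: class_sizes_def sum_unfold_sum_mset image_mset.compositionality comp_def)

lemma sum_mset_mset_nth: "(\<Sum>x\<in>#mset xs. f x) = (\<Sum>i<length xs. f (xs ! i))"
proof -
  have "(\<Sum>x\<in>#mset xs. f x) = (\<Sum>x\<leftarrow>xs. f x)"
    by (simp flip: sum_mset_sum_list)
  then show ?thesis by (simp add: sum_list_sum_nth atLeast0LessThan)
qed

text \<open>
  Each contrast is a unit vector at which the quadratic form is at least \<open>n\<close> plus the size of its
  cell, and contrasts of distinct elements are orthogonal, so Ky Fan's inequality applies.
\<close>

theorem laplacian_eigenvalue_sum_bound:
  assumes sym: "\<And>a b. a < n \<Longrightarrow> b < n \<Longrightarrow> d a b = d b a"
    and one: "\<And>a b. a < n \<Longrightarrow> b < n \<Longrightarrow> a \<noteq> b \<Longrightarrow> 1 \<le> d a b"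
    and two: "\<And>a b. a < n \<Longrightarrow> b < n \<Longrightarrow> a \<noteq> b \<Longrightarrow> cl a = cl b \<Longrightarrow> 2 \<le> d a b"
    and as: "distinct as" "\<And>a. a \<in> set as \<Longrightarrow> a < n \<and> earlier cl a \<noteq> {}" and r: "r \<le> length as"
  shows "(\<Sum>k<r. real n + real (card (cell n cl (cl (as ! k)))))
    \<le> (\<Sum>i<r. eigenvalues_desc (mat n n (\<lambda>(a, b). weighted_laplacian n d a b)) ! i)"
proof -
  have orth: "orthonormal n r (\<lambda>k. helmert cl (as ! k))"
    by (rule orthonormal_helmert[OF as r])
  have "length as \<le> n"
    using as by (metis card_lessThan card_mono distinct_card finite_lessThan lessThan_iff subsetI)
  with r have "r \<le> n" by simp
  have "(\<Sum>k<r. real n + real (card (cell n cl (cl (as ! k)))))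
      \<le> (\<Sum>k<r. dot n (helmert cl (as ! k)) (apply_mat n (weighted_laplacian n d) (helmert cl (as ! k))))"
  proof (rule sum_mono)
    fix k assume "k \<in> {..<r}"
    then have k: "k < r" by simp
    with r as have "as ! k < n" by simp
    then have "(real n + real (card (cell n cl (cl (as ! k))))) * dot n (helmert cl (as ! k)) (helmert cl (as ! k))
      \<le> dot n (helmert cl (as ! k)) (apply_mat n (weighted_laplacian n d) (helmert cl (as ! k)))"
      by (intro laplacian_bound_on_cell sym one two sum_helmert helmert_support)
    then show "real n + real (card (cell n cl (cl (as ! k))))
      \<le> dot n (helmert cl (as ! k)) (apply_mat n (weighted_laplacian n d) (helmert cl (as ! k)))"
      by (simp add: orthonormalD[OF orth k k])
  qed
  also have "\<dots> \<le> (\<Sum>i<r. eigenvalues_desc (mat n n (\<lambda>(a, b). weighted_laplacian n d a b)) ! i)"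
    by (rule ky_fan_inequality[OF _ orth \<open>r \<le> n\<close>]) (simp add: weighted_laplacian_def sym)
  finally show ?thesis .
qed

theorem theorem6p4:
  fixes G :: "('a, 'b) pre_digraph"
    and vs :: "'a list"
    and P :: "'a set set"
    and n \<chi> :: nat
    and ls \<Theta> :: "nat list"
  assumes graph: "graph G"
    and conn: "Digraph_Component.connected G"
    and enum: "distinct vs" "set vs = verts G"
    and n: "n = card (verts G)"
    and chi: "\<chi> = chromatic_number G"
    and coloring: "proper_coloring G P" "card P = \<chi>"
    and sizes: "ls = class_sizes P"
    and Theta: "\<Theta> = Theta_list n ls"
  shows "(\<forall>r. 1 \<le> r \<and> r \<le> n - \<chi> \<longrightarrow>
            (\<Sum>i=1..r. dist_lap_eigenvalue G vs i) \<ge> (\<Sum>i=1..r. real (\<Theta> ! (i - 1))))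
       \<and> (\<Sum>i=1..n - \<chi>. dist_lap_eigenvalue G vs i)
            \<ge> (\<Sum>j=1..\<chi>. (real (ls ! (j - 1)) - 1) * (real n + real (ls ! (j - 1))))"
proof -
  interpret graph G by (rule graph)
  have len: "length vs = n" using enum n by (metis distinct_card)
  have part: "partition_on (verts G) P" and indep: "\<And>C. C \<in> P \<Longrightarrow> independent_set G C"
    using coloring(1) by (auto simp: proper_coloring_def)
  have finP: "finite P" by (rule finite_elements[OF _ part]) simp
  have finC: "finite C" if "C \<in> P" for C
    using that part by (metis finite_verts partition_onD1 Union_upper finite_subset)
  have pos: "1 \<le> card C" if "C \<in> P" for C
    using that part finC by (metis One_nat_def Suc_leI card_gt_0_iff partition_onD3)
  \<comment> \<open>The cells of the vertex indices are the color classes.\<close>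
  define cl where "cl a = (THE C. C \<in> P \<and> vs ! a \<in> C)" for a
  have cl_eq: "cl a = C" if "C \<in> P" "vs ! a \<in> C" for a C
    unfolding cl_def using that partition_onD2[OF part]
    by (intro the_equality) (auto simp: disjoint_def)
  have cl: "cl a \<in> P" "vs ! a \<in> cl a" if "a < n" for a
  proof -
    have "vs ! a \<in> \<Union>P"
      using that len enum partition_onD1[OF part] by (metis nth_mem)
    then show "cl a \<in> P" "vs ! a \<in> cl a" using cl_eq by auto
  qed
  have cell_card: "card (cell n cl C) = card C" if C: "C \<in> P" for C
  proof -
    have "(!) vs ` cell n cl C = C"
    proof
      show "(!) vs ` cell n cl C \<subseteq> C" using cl(2) by (auto simp: cell_def)
      show "C \<subseteq> (!) vs ` cell n cl C"
      proof
        fix v assume v: "v \<in> C"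
        then have "v \<in> set vs" using C enum(2) partition_onD1[OF part] by auto
        then obtain a where "a < n" "vs ! a = v" using len by (auto simp: in_set_conv_nth)
        with cl_eq[OF C] v show "v \<in> (!) vs ` cell n cl C" by (auto simp: cell_def)
      qed
    qed
    moreover have "inj_on ((!) vs) (cell n cl C)"
      using enum(1) len by (auto simp: inj_on_def cell_def nth_eq_iff_index_eq)
    ultimately show ?thesis by (metis card_image)
  qed
  have range_cl: "cl ` {..<n} = P"
  proof
    show "cl ` {..<n} \<subseteq> P" using cl(1) by auto
    show "P \<subseteq> cl ` {..<n}"
    proof
      fix C assume C: "C \<in> P"
      with cell_card[OF C] pos[OF C] have "cell n cl C \<noteq> {}" by auto
      then show "C \<in> cl ` {..<n}" by (auto simp: cell_def)
    qed
  qed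

  \<comment> \<open>The indices that are not first in their class, ordered so that the values n + (class size) form the list in question.\<close>
  define N where "N = filter (\<lambda>a. earlier cl a \<noteq> {}) [0..<n]"
  define g where "g a = n + card (cl a)" for a
  define as where "as = rev (sort_key g N)"
  have setN: "set N = {a. a < n \<and> earlier cl a \<noteq> {}}" by (auto simp: N_def)
  have as: "distinct as" "set as = set N"
    by (auto simp: as_def N_def)
  have mset_g: "mset (map g N) = (\<Sum>C\<in>P. replicate_mset (card C - 1) (n + card C))"
  proof -
    have "mset (map g N) = image_mset g (mset_set (set N))"
      by (simp add: N_def mset_set_set)
    also have "\<dots> = (\<Sum>C\<in>cl ` {..<n}. replicate_mset (card (cell n cl C) - 1) (n + card C))"
      unfolding setN g_def by (rule mset_nonfirst_by_cell)
    also have "\<dots> = (\<Sum>C\<in>P. replicate_mset (card C - 1) (n + card C))"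
      unfolding range_cl by (intro sum.cong refl) (simp add: cell_card)
    finally show ?thesis .
  qed
  have mset_Theta: "mset \<Theta> = (\<Sum>C\<in>P. replicate_mset (card C - 1) (n + card C))"
    unfolding Theta mset_Theta_list sizes by (rule sum_mset_class_sizes)
  have "sort (map g N) = rev \<Theta>"
  proof (rule properties_for_sort)
    show "mset (rev \<Theta>) = mset (map g N)" by (simp only: mset_rev mset_Theta mset_g)
    show "sorted (rev \<Theta>)" by (simp add: Theta Theta_list_def)
  qed
  then have Theta_map: "\<Theta> = map g as"
    by (metis as_def rev_map rev_rev_ident sort_map_sort_key)
  have length_Theta: "length \<Theta> = n - \<chi>"
  proof -
    have "length \<Theta> = size (mset \<Theta>)" by simp
    also have "\<dots> = (\<Sum>C\<in>P. card C - 1)"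
      unfolding mset_Theta by simp
    also have "\<dots> = (\<Sum>C\<in>P. card C) - (\<Sum>C\<in>P. 1)"
      by (rule sum_subtractf_nat) (rule pos)
    also have "(\<Sum>C\<in>P. card C) = n"
      unfolding n partition_onD1[OF part]
      by (rule card_Union_disjoint[symmetric]) (use partition_onD2[OF part] finC in \<open>auto simp: disjoint_def pairwise_def disjnt_def\<close>)
    finally show ?thesis using coloring(2) by simp
  qed

  let ?d = "\<lambda>a b. real (graph_dist G (vs ! a) (vs ! b))"
  have vert: "vs ! a \<in> verts G" if "a < n" for a
    using that len enum(2) by auto
  have neq: "vs ! a \<noteq> vs ! b" if "a < n" "b < n" "a \<noteq> b" for a b
    using that len enum(1) by (simp add: nth_eq_iff_index_eq)
  have bound: "(\<Sum>i<r. real (\<Theta> ! i)) \<le> (\<Sum>i<r. dist_lap_eigenvalue G vs (Suc i))" if "r \<le> n - \<chi>" for r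
  proof -
    have r: "r \<le> length as" using that length_Theta Theta_map by simp
    have "(\<Sum>i<r. real (\<Theta> ! i)) = (\<Sum>k<r. real n + real (card (cell n cl (cl (as ! k)))))"
    proof (intro sum.cong refl)
      fix k assume "k \<in> {..<r}"
      then have k: "k < length as" using r by simp
      then have "as ! k < n" using as(2) setN nth_mem by blast
      with k show "real (\<Theta> ! k) = real n + real (card (cell n cl (cl (as ! k))))"
        by (simp add: Theta_map g_def cell_card cl)
    qed
    also have "\<dots> \<le> (\<Sum>i<r. eigenvalues_desc (mat n n (\<lambda>(a, b). weighted_laplacian n ?d a b)) ! i)"
    proof (rule laplacian_eigenvalue_sum_bound[OF _ _ _ as(1) _ r])
      show "?d a b = ?d b a" for a b by (simp add: graph_dist_commute[of "vs ! a"])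
      show "1 \<le> ?d a b" if "a < n" "b < n" "a \<noteq> b" for a b
        using graph_dist_ge_1[OF conn vert vert neq] that by simp
      show "2 \<le> ?d a b" if ab: "a < n" "b < n" "a \<noteq> b" "cl a = cl b" for a b
      proof -
        have "\<not> vs ! a \<rightarrow>\<^bsub>G\<^esub> vs ! b"
          using indep[OF cl(1)[OF ab(1)]] cl(2)[OF ab(1)] cl(2)[OF ab(2)] ab(4)
          by (simp add: independent_set_def)
        from graph_dist_ge_2[OF conn vert vert neq this] ab show ?thesis by simp
      qed
      show "a < n \<and> earlier cl a \<noteq> {}" if "a \<in> set as" for a
        using that as(2) setN by blast
    qed
    also have "\<dots> = (\<Sum>i<r. dist_lap_eigenvalue G vs (Suc i))"
      by (simp add: dist_lap_eigenvalue_def distance_laplacian_eq_weighted_laplacian[OF enum] len)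
    finally show ?thesis .
  qed
  have shift: "(\<Sum>i=1..r. f i) = (\<Sum>i<r. f (Suc i))" for r and f :: "nat \<Rightarrow> real"
    by (simp add: sum.atLeast1_atMost_eq)
  have total: "(\<Sum>i<n - \<chi>. real (\<Theta> ! i)) = (\<Sum>j<\<chi>. (real (ls ! j) - 1) * (real n + real (ls ! j)))"
  proof -
    have "(\<Sum>i<n - \<chi>. real (\<Theta> ! i)) = (\<Sum>t\<in>#mset \<Theta>. real t)"
      unfolding length_Theta[symmetric] by (rule sum_mset_mset_nth[of real \<Theta>, symmetric])
    also have "\<dots> = (\<Sum>C\<in>P. real (card C - 1) * (real n + real (card C)))"
      unfolding mset_Theta using finP by (induction P rule: finite_induct) (simp_all add: algebra_simps)
    also have "\<dots> = (\<Sum>C\<in>P. (real (card C) - 1) * (real n + real (card C)))"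
      by (intro sum.cong refl) (use pos in \<open>simp add: of_nat_diff\<close>)
    also have "\<dots> = (\<Sum>l\<in>#mset ls. (real l - 1) * (real n + real l))"
      unfolding sizes by (rule sum_mset_class_sizes[symmetric])
    also have "\<dots> = (\<Sum>j<length ls. (real (ls ! j) - 1) * (real n + real (ls ! j)))"
      by (rule sum_mset_mset_nth)
    also have "length ls = \<chi>"
      using coloring(2)
      by (simp only: sizes class_sizes_def mset_rev mset_sorted_list_of_multiset size_image_mset
          size_mset_set flip: size_mset)
    finally show ?thesis .
  qed
  show ?thesis
    unfolding shift diff_Suc_1 total[symmetric] using bound by blast
qed

end
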